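(* Let $n\ge 0$, $m\ge 1$, and $0\le k\le m-1$ be integers, and let $\mathbf a$ be the area sequence of the melting lollipop graph $L_{m,n}^{(k)}$ on $n+m$ vertices. Then $$\mathrm{LLT}_{\mathbf a}(\mathbf x;q)=\sum_{\alpha\vDash n+m}q^{\mathbf a(\mathrm{set}(\alpha))}\,r_\alpha .$$
   Context: Notation: $[n]=\{1,\dots,n\}$; $\mathbb N$ is the set of positive integers and $\mathbf x=(x_1,x_2,\dots)$ are commuting variables; $q$ is an indeterminate. Compositions: a composition $\alpha=\alpha_1\cdots\alpha_\ell$ of $n$ (written $\alpha\vDash n$) is an ordered list of positive integers with sum $n$; $\mathrm{set}(\alpha)=\{\alpha_1,\alpha_1+\alpha_2,\dots,\alpha_1+\dots+\alpha_{\ell-1}\}\subseteq[n-1]$. For a list of integers $\mathbf v=(v_1,\dots,v_{n})$ and $S\subseteq[n]$, $\mathbf v(S)=\sum_{s\in S}v_s$. Ribbon Schur functions: for $\alpha\vDash n$, $r_\alpha=\sum_\kappa x_{\kappa(1)}\cdots x_{\kappa(n)}$, the sum over all maps $\kappa:[n]\to\mathbb N$ such that for each $i\in[n-1]$, $\kappa(i)<\kappa(i+1)$ if $i\in\mathrm{set}(\alpha)$ and $\kappa(i)\ge\kappa(i+1)$ if $i\notin\mathrm{set}(\alpha)$. Graphs: edges are written $(i,j)$ with $i<j$. A unit interval graph $G$ on $n$ vertices is a graph with vertex set $[n]$ such that if $(i,j)\in E(G)$ and $i\le k<l\le j$ then $(k,l)\in E(G)$. Its area sequence is $\mathbf a=(a_1,\dots,a_{n-1})$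 with $a_i=\max(\{0\}\cup\{j-i:(i,j)\in E(G)\})$. The area sequence determines $G$. The unicellular LLT polynomial of $\mathbf a$ (or of $G$) is $$\mathrm{LLT}_{\mathbf a}(\mathbf x;q)=\sum_{\kappa:[n]\to\mathbb N}q^{\mathrm{asc}(\kappa)}x_{\kappa(1)}\cdots x_{\kappa(n)},$$ where $\mathrm{asc}(\kappa)$ is the number of $(i,j)\in E(G)$ with $i<j$ and $\kappa(i)<\kappa(j)$. $K_n$ is the complete graph on $[n]$; the path $P_n$ has vertex set $[n]$ and edges $(i,i+1)$, $1\le i\le n-1$. The concatenation $G+H$ of unit interval graphs $G$ and $H$ on $n$ and $m$ vertices is the unit interval graph on $[n+m-1]$ with edge set $E(G)\cup\{(i+n-1,j+n-1):(i,j)\in E(H)\}$. For $m\ge1$ and $0\le k\le m-1$, the melting complete graph $K_m^{(k)}$ is the unit interval graph on $m$ vertices obtained from $K_m$ by removing the $k$ edges $(1,m),(1,m-1),\dots,(1,m-k+1)$. For $n\ge0$, $m\ge1$, $0\le k\le m-1$, the melting lollipop graph $L_{m,n}^{(k)}$ is the unit interval graph on $n+m$ vertices given by the concatenation $P_{n+1}+K_m^{(k)}$. *)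

theory Defs
  imports Main "HOL-Library.FuncSet" "HOL-Library.Poly_Mapping"
    "HOL-Computational_Algebra.Polynomial"
begin

text \<open>
  A formal power series in commuting variables \<open>x\<^sub>1, x\<^sub>2, \<dots>\<close> over \<open>\<int>[q]\<close> is
  represented by its coefficient function: a monomial is its exponent vector, a finitely
  supported map from variable indices to exponents, and series are added and multiplied by
  elements of \<open>\<int>[q]\<close> pointwise.
\<close>

type_synonym series = "(nat \<Rightarrow>\<^sub>0 nat) \<Rightarrow> int poly"

definition colourings :: "nat \<Rightarrow> (nat \<Rightarrow> nat) set" where
  "colourings n = {1..n} \<rightarrow>\<^sub>E {1..}"

definition monomial :: "nat \<Rightarrow> (nat \<Rightarrow> nat) \<Rightarrow> (nat \<Rightarrow>\<^sub>0 nat)" where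
  "monomial n \<kappa> = (\<Sum>i = 1..n. Poly_Mapping.single (\<kappa> i) 1)"

text \<open>
  The formal sum of \<open>w \<kappa> * x\<^bsub>\<kappa> 1\<^esub> \<dots> x\<^bsub>\<kappa> n\<^esub>\<close> over the
  \<open>\<kappa> \<in> A\<close>, where \<open>A \<subseteq> colourings n\<close>. For a fixed monomial only finitely many
  colourings contribute, as \<open>finite_colourings_monomial\<close> below shows.
\<close>

definition formal_sum ::
    "nat \<Rightarrow> (nat \<Rightarrow> nat) set \<Rightarrow> ((nat \<Rightarrow> nat) \<Rightarrow> int poly) \<Rightarrow> series" where
  "formal_sum n A w = (\<lambda>\<mu>. \<Sum>\<kappa> \<in> {\<kappa> \<in> A. monomial n \<kappa> = \<mu>}. w \<kappa>)"

lemma finite_colourings_monomial: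
  "finite {\<kappa> \<in> colourings n. monomial n \<kappa> = \<mu>}"
proof (rule finite_subset)
  have "\<kappa> i \<in> Poly_Mapping.keys (monomial n \<kappa>)" if "i \<in> {1..n}" for \<kappa> i
  proof -
    have "Poly_Mapping.lookup (monomial n \<kappa>) (\<kappa> i) = (\<Sum>j = 1..n. (1 when \<kappa> j = \<kappa> i))"
      by (simp add: monomial_def lookup_sum lookup_single)
    also have "\<dots> \<ge> (1 when \<kappa> i = \<kappa> i)"
      using that by (intro member_le_sum) auto
    finally show ?thesis
      by (simp add: in_keys_iff)
  qed
  then show "{\<kappa> \<in> colourings n. monomial n \<kappa> = \<mu>} \<subseteq> {1..n} \<rightarrow>\<^sub>E Poly_Mapping.keys \<mu>"
    by (auto simp: colourings_def PiE_iff extensional_def simp del: atLeastAtMost_iff)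
  show "finite ({1..n} \<rightarrow>\<^sub>E Poly_Mapping.keys \<mu>)"
    by (intro finite_PiE) auto
qed


definition compositions :: "nat \<Rightarrow> nat list set" where
  "compositions n = {\<alpha>. (\<forall>a \<in> set \<alpha>. 0 < a) \<and> sum_list \<alpha> = n}"

lemma finite_compositions: "finite (compositions n)"
proof (rule finite_subset)
  have "length \<alpha> \<le> sum_list \<alpha>" if "\<forall>a \<in> set \<alpha>. 0 < a" for \<alpha> :: "nat list"
    using that by (induction \<alpha>) auto
  then show "compositions n \<subseteq> {\<alpha>. set \<alpha> \<subseteq> {..n} \<and> length \<alpha> \<le> n}"
    by (auto simp: compositions_def dest: member_le_sum_list)
  show "finite {\<alpha>. set \<alpha> \<subseteq> {..n} \<and> length \<alpha> \<le> n}"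
    by (intro finite_lists_length_le) simp
qed

definition comp_set :: "nat list \<Rightarrow> nat set" where
  "comp_set \<alpha> = {sum_list (take i \<alpha>) | i. 1 \<le> i \<and> i < length \<alpha>}"

text \<open>\<open>\<^bold>v(S)\<close> for a list \<open>\<^bold>v\<close> whose entries are numbered from 1.\<close>

definition list_sum_on :: "nat list \<Rightarrow> nat set \<Rightarrow> nat" where
  "list_sum_on v S = (\<Sum>s \<in> S. v ! (s - 1))"

definition ribbon_schur :: "nat list \<Rightarrow> series" where
  "ribbon_schur \<alpha> = (let n = sum_list \<alpha> in
     formal_sum n
       {\<kappa> \<in> colourings n. \<forall>i \<in> {1..<n}.
          (i \<in> comp_set \<alpha> \<longrightarrow> \<kappa> i < \<kappa> (i + 1)) \<and>
          (i \<notin> comp_set \<alpha> \<longrightarrow> \<kappa> i \<ge> \<kappa> (i + 1))}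
       (\<lambda>\<kappa>. 1))"


text \<open>
  The vertices of a graph \<open>G\<close> are \<open>1, \<dots>, vertex_count G\<close>; an edge is listed once, as the pair
  \<open>(i, j)\<close> with \<open>i < j\<close>.
\<close>

record graph =
  vertex_count :: nat
  edges :: "(nat \<times> nat) set"

definition unit_interval_graph :: "graph \<Rightarrow> bool" where
  "unit_interval_graph G \<longleftrightarrow>
     edges G \<subseteq> {(i, j). 1 \<le> i \<and> i < j \<and> j \<le> vertex_count G} \<and>
     (\<forall>i j k l. (i, j) \<in> edges G \<and> i \<le> k \<and> k < l \<and> l \<le> j \<longrightarrow> (k, l) \<in> edges G)"

definition area_sequence :: "graph \<Rightarrow> nat list" where
  "area_sequence G =
     map (\<lambda>i. Max ({0} \<union> {j - i | j. (i, j) \<in> edges G})) [1..<vertex_count G]"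

definition asc :: "graph \<Rightarrow> (nat \<Rightarrow> nat) \<Rightarrow> nat" where
  "asc G \<kappa> = card {(i, j) \<in> edges G. i < j \<and> \<kappa> i < \<kappa> j}"

definition LLT :: "graph \<Rightarrow> series" where
  "LLT G = formal_sum (vertex_count G) (colourings (vertex_count G)) (\<lambda>\<kappa>. monom 1 (asc G \<kappa>))"

definition complete_graph :: "nat \<Rightarrow> graph" where
  "complete_graph n = \<lparr>vertex_count = n, edges = {(i, j). 1 \<le> i \<and> i < j \<and> j \<le> n}\<rparr>"

definition path_graph :: "nat \<Rightarrow> graph" where
  "path_graph n = \<lparr>vertex_count = n, edges = {(i, i + 1) | i. 1 \<le> i \<and> i < n}\<rparr>"

definition concatenation :: "graph \<Rightarrow> graph \<Rightarrow> graph" where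
  "concatenation G H =
     \<lparr>vertex_count = vertex_count G + vertex_count H - 1,
      edges = edges G \<union> {(i + vertex_count G - 1, j + vertex_count G - 1) | i j. (i, j) \<in> edges H}\<rparr>"

definition melting_complete_graph :: "nat \<Rightarrow> nat \<Rightarrow> graph" where
  "melting_complete_graph m k =
     \<lparr>vertex_count = m,
      edges = edges (complete_graph m) - {(1, j) | j. m - k + 1 \<le> j \<and> j \<le> m}\<rparr>"

definition melting_lollipop_graph :: "nat \<Rightarrow> nat \<Rightarrow> nat \<Rightarrow> graph" where
  "melting_lollipop_graph m n k =
     concatenation (path_graph (n + 1)) (melting_complete_graph m k)"

text \<open>
  The area sequence determines a unit interval graph, so \<open>LLT\<close> may equally be regarded as
  a function of the area sequence.
\<close>

lemma unit_interval_graph_edge_iff: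
  assumes "unit_interval_graph G" "1 \<le> i" "i < vertex_count G"
  shows "(i, j) \<in> edges G \<longleftrightarrow> i < j \<and> j \<le> i + area_sequence G ! (i - 1)"
proof -
  let ?D = "{0} \<union> {j - i | j. (i, j) \<in> edges G}"
  have "?D \<subseteq> {..vertex_count G}"
    using assms(1) by (force simp: unit_interval_graph_def)
  then have fin: "finite ?D"
    by (rule finite_subset) simp
  have a: "area_sequence G ! (i - 1) = Max ?D"
    using assms nth_upt[of 1 "i - 1" "vertex_count G"] by (simp add: area_sequence_def)
  show ?thesis
  proof
    assume e: "(i, j) \<in> edges G"
    then have "i < j"
      using assms(1) by (auto simp: unit_interval_graph_def)
    moreover have "j - i \<le> Max ?D"
      using e fin by (intro Max_ge) auto
    ultimately show "i < j \<and> j \<le> i + area_sequence G ! (i - 1)"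
      using a by linarith
  next
    assume j: "i < j \<and> j \<le> i + area_sequence G ! (i - 1)"
    have "Max ?D \<in> ?D"
      using fin by (intro Max_in) auto
    moreover have "Max ?D \<noteq> 0"
      using j a by linarith
    ultimately obtain l where l: "Max ?D = l - i" "(i, l) \<in> edges G"
      by auto
    have "j \<le> l"
      using j a l(1) by linarith
    then show "(i, j) \<in> edges G"
      using assms(1) l(2) j unfolding unit_interval_graph_def by blast
  qed
qed

lemma area_sequence_determines:
  fixes G H :: graph
  assumes "unit_interval_graph G" "unit_interval_graph H"
    and "vertex_count G = vertex_count H" "area_sequence G = area_sequence H"
  shows "G = H"
proof -
  have "(i, j) \<in> edges G \<longleftrightarrow> (i, j) \<in> edges H" for i j
  proof (cases "1 \<le> i \<and> i < vertex_count G")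
    case True
    then show ?thesis
      using assms unit_interval_graph_edge_iff[of G i j] unit_interval_graph_edge_iff[of H i j]
      by simp
  next
    case False
    then show ?thesis
      using assms(1-3) by (force simp: unit_interval_graph_def)
  qed
  then have "edges G = edges H"
    by auto
  then show ?thesis
    using assms(3) by simp
qed

lemma unit_interval_graph_melting_lollipop_graph:
  assumes "1 \<le> m" "k \<le> m - 1"
  shows "unit_interval_graph (melting_lollipop_graph m n k)"
    and "vertex_count (melting_lollipop_graph m n k) = n + m"
proof -
  let ?G = "melting_lollipop_graph m n k"
  show "vertex_count ?G = n + m"
    by (simp add: melting_lollipop_graph_def concatenation_def path_graph_def
        melting_complete_graph_def)
  have E: "(i, j) \<in> edges ?G \<longleftrightarrow>
      1 \<le> i \<and> i < j \<and> j \<le> n + m \<and>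
      (i \<le> n \<and> j = i + 1 \<or> i = n + 1 \<and> j \<le> n + m - k \<or> n + 1 < i)" (is "_ \<longleftrightarrow> ?R") for i j
  proof
    assume "(i, j) \<in> edges ?G"
    then show ?R
      using assms
      by (auto simp: melting_lollipop_graph_def concatenation_def path_graph_def
          melting_complete_graph_def complete_graph_def)
  next
    assume R: ?R
    show "(i, j) \<in> edges ?G"
    proof (cases "i \<le> n")
      case True
      then show ?thesis
        using R by (auto simp: melting_lollipop_graph_def concatenation_def path_graph_def)
    next
      case False
      then have "(i - n, j - n) \<in> edges (melting_complete_graph m k)"
        using R assms by (auto simp: melting_complete_graph_def complete_graph_def)
      moreover have "i = (i - n) + n" "j = (j - n) + n"
        using False R by auto
      ultimately show ?thesis
        by (fastforce simp: melting_lollipop_graph_def concatenation_def path_graph_def)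
    qed
  qed
  show "unit_interval_graph ?G"
    unfolding unit_interval_graph_def \<open>vertex_count ?G = n + m\<close>
    by (auto simp: E)
qed

end

theory Submission
  imports Defs
begin

text \<open>
  A colouring \<open>\<kappa>\<close> satisfies the inequalities of exactly one ribbon, the one whose composition
  \<open>\<alpha>\<close> has \<open>comp_set \<alpha>\<close> equal to the set of \<open>i\<close> with \<open>\<kappa> i < \<kappa> (i + 1)\<close>. So the right-hand side
  is the sum over all colourings, weighted by \<open>q\<close> to the sum of \<open>a\<^sub>i\<close> over these \<open>i\<close>
  (\<open>sum_ribbon_schur\<close>). The left-hand side weights the same colourings by the number of edges
  that ascend. What has to be shown is that, on the words with a prescribed multiset of letters, the
  two statistics \<open>area_ascents\<close> and \<open>area_major\<close> have the same distribution.

  For a complete graph, this is up to reversals MacMahon's theorem that the inversion number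
  and the major index are equidistributed, and Foata's bijection proves it. The proof here
  is a partial version of that bijection. A word is built from right to left by
  putting a letter \<open>x\<close> in front of a word \<open>w\<close>, and \<open>x\<close> is joined by edges to the first \<open>a\<close>
  letters of \<open>w\<close>. On one side the new letter contributes \<open>a\<close> or \<open>0\<close>, according to whether it is
  smaller than the first letter of \<open>w\<close>; on the other side it contributes the number of those
  \<open>a\<close> letters that exceed it. To compensate, the first \<open>a\<close> letters of \<open>w\<close> are permuted by a step
  of Foata's transformation (\<open>sweep\<close>), which changes the number of ascending pairs among them by
  exactly the difference (\<open>pair_ascents_prefix_sweep\<close>).

  This needs that permuting the first \<open>a\<close> letters has the same effect on ascending edges as on
  ascending pairs, which holds when \<open>w\<close> lies on a complete graph. A melting lollipop graph meets
  this requirement: the letters of the complete part are added first; the first vertex of the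
  melting clique is joined to a prefix of a complete graph; and on the path \<open>a = 1\<close>, where
  nothing is permuted.
\<close>

section \<open>Two statistics on words\<close>

text \<open>
  A word \<open>w\<close> of length \<open>n\<close> gives the colours of the vertices \<open>1, \<dots>, n\<close>, and a list \<open>as\<close> of the same
  length gives their areas; the last vertex is included, with area \<open>0\<close>, so that the recursions on
  both lists run in parallel.
\<close>

primrec pair_ascents :: "nat list \<Rightarrow> nat" where
  "pair_ascents [] = 0"
| "pair_ascents (x # w) = length (filter (\<lambda>y. x < y) w) + pair_ascents w"

fun area_ascents :: "nat list \<Rightarrow> nat list \<Rightarrow> nat" where
  "area_ascents (a # as) (x # w) = length (filter (\<lambda>y. x < y) (take a w)) + area_ascents as w"
| "area_ascents _ _ = 0"

fun area_major :: "nat list \<Rightarrow> nat list \<Rightarrow> nat" where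
  "area_major (a # as) (x # w) = (if w \<noteq> [] \<and> x < hd w then a else 0) + area_major as w"
| "area_major _ _ = 0"

text \<open>
  The list \<open>[n - 1, \<dots>, 1, 0]\<close> is the area list of the complete graph, where every pair of positions
  is an edge.
\<close>

lemma area_ascents_complete: "area_ascents (rev [0..<length w]) w = pair_ascents w"
  by (induction w) auto

lemma area_ascents_eq_sum:
  assumes "length as = length w"
  shows "area_ascents as w =
    (\<Sum>i<length w. card {j. i < j \<and> j < length w \<and> j \<le> i + as ! i \<and> w ! i < w ! j})"
proof -
  have step: "length (filter (\<lambda>y. x < y) (take a u)) =
      card {j. 0 < j \<and> j < length (x # u) \<and> j \<le> 0 + a \<and> (x # u) ! 0 < (x # u) ! j}"
    for a x and u :: "nat list"
  proof -
    have "length (filter (\<lambda>y. x < y) (take a u)) = card {j. j < a \<and> j < length u \<and> x < u ! j}"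
      unfolding length_filter_conv_card by (rule arg_cong[where f = card]) auto
    also have "\<dots> = card (Suc ` {j. j < a \<and> j < length u \<and> x < u ! j})"
      by (simp add: card_image)
    also have "Suc ` {j. j < a \<and> j < length u \<and> x < u ! j} =
        {j. 0 < j \<and> j < length (x # u) \<and> j \<le> 0 + a \<and> (x # u) ! 0 < (x # u) ! j}"
      by (auto simp: image_iff gr0_conv_Suc)
    finally show ?thesis .
  qed
  have shift: "card {j. Suc i < j \<and> j < length (x # u) \<and> j \<le> Suc i + b \<and> z < (x # u) ! j} =
      card {j. i < j \<and> j < length u \<and> j \<le> i + b \<and> z < u ! j}" for i b x z and u :: "nat list"
  proof -
    have "{j. Suc i < j \<and> j < length (x # u) \<and> j \<le> Suc i + b \<and> z < (x # u) ! j} =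
        Suc ` {j. i < j \<and> j < length u \<and> j \<le> i + b \<and> z < u ! j}"
      by (auto simp: image_iff less_Suc_eq_0_disj Suc_less_eq2)
    then show ?thesis
      by (simp add: card_image)
  qed
  show ?thesis
    using assms
  proof (induction as w rule: list_induct2)
    case (Cons a as x w)
    have "area_ascents (a # as) (x # w) = length (filter (\<lambda>y. x < y) (take a w)) +
       (\<Sum>i<length w. card {j. i < j \<and> j < length w \<and> j \<le> i + as ! i \<and> w ! i < w ! j})"
      using Cons.IH by simp
    also have "\<dots> = (\<Sum>i<Suc (length w). card {j. i < j \<and> j < length (x # w) \<and>
        j \<le> i + (a # as) ! i \<and> (x # w) ! i < (x # w) ! j})"
      unfolding sum.lessThan_Suc_shift nth_Cons_Suc shift step nth_Cons_0 ..
    finally show ?case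
      by simp
  qed simp
qed

lemma area_major_eq_sum:
  assumes "length as = length w"
  shows "area_major as w = (\<Sum>i \<in> {i. Suc i < length w \<and> w ! i < w ! Suc i}. as ! i)"
  using assms
proof (induction as w rule: list_induct2)
  case (Cons a as x w)
  let ?D = "\<lambda>w. {i. Suc i < length w \<and> w ! i < w ! Suc i}"
  have fin: "finite (?D w)"
    by (rule finite_subset[of _ "{..<length w}"]) auto
  have D: "?D (x # w) = (if w \<noteq> [] \<and> x < hd w then {0} else {}) \<union> Suc ` ?D w"
  proof (rule set_eqI)
    show "i \<in> ?D (x # w) \<longleftrightarrow> i \<in> (if w \<noteq> [] \<and> x < hd w then {0} else {}) \<union> Suc ` ?D w" for i
      by (cases i; cases w) auto
  qed
  have "(\<Sum>i \<in> Suc ` ?D w. (a # as) ! i) = area_major as w"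
    using Cons.IH by (simp add: sum.reindex)
  then show ?case
    using fin unfolding D by (simp add: sum.insert)
qed simp

section \<open>Foata's transformation\<close>

text \<open>
  One step of Foata's transformation, relative to a pivot \<open>x\<close> and applied to \<open>b # w\<close>. Call letters
  equivalent when they lie on the same side of \<open>x\<close>. The word is cut before each letter equivalent to
  its first letter \<open>b\<close>, and in each block the leading letter is moved to the end. The argument
  \<open>b\<close> of the recursion is the leading letter that is currently being carried to the right.
\<close>

fun sweep :: "nat \<Rightarrow> nat \<Rightarrow> nat list \<Rightarrow> nat list" where
  "sweep x b [] = [b]"
| "sweep x b (y # w) =
    (if (x < y) = (x < b) then b # sweep x y w else y # sweep x b w)"

lemma mset_sweep [simp]: "mset (sweep x b w) = mset (b # w)"
  by (induction w arbitrary: b) auto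

lemma length_sweep [simp]: "length (sweep x b w) = Suc (length w)"
  using mset_sweep[of x b w, THEN mset_eq_length] by simp

lemma length_filter_sweep [simp]:
  "length (filter P (sweep x b w)) = length (filter P (b # w))"
  by (metis mset_filter mset_sweep size_mset)

text \<open>
  The last letter of the result is one of the carried letters, so it reveals on which side of the
  pivot these letters lie. This makes the step reversible.
\<close>

lemma last_sweep: "(x < last (sweep x b w)) = (x < b)"
proof -
  have "sweep x b w \<noteq> []" for b w
    using length_sweep[of x b w] by fastforce
  then show ?thesis
    by (induction w arbitrary: b) auto
qed

lemma sweep_inject:
  assumes "sweep x b w = sweep x b' w'"
  shows "b = b' \<and> w = w'"
proof -
  have len: "length w = length w'"
    using arg_cong[OF assms, of length] by simp
  have "(x < b) = (x < b')"
    using assms by (metis last_sweep)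
  with len assms show ?thesis
    by (induction w w' arbitrary: b b' rule: list_induct2) (auto split: if_splits)
qed

text \<open>
  In each block, the carried letter is moved past the letters on the other side of \<open>x\<close>. If it
  exceeds \<open>x\<close>, each of these letters becomes the smaller and earlier member of a pair, so a new
  ascending pair arises; otherwise an ascending pair is lost. Every letter not equivalent to
  \<open>b\<close> lies in one block and is passed exactly once.
\<close>

lemma pair_ascents_sweep:
  "pair_ascents (sweep x b w) + (if x < b then 0 else length (filter (\<lambda>y. x < y) w)) =
    pair_ascents (b # w) + (if x < b then length (filter (\<lambda>y. \<not> x < y) w) else 0)"
proof (induction w arbitrary: b)
  case (Cons y w)
  show ?case
    using Cons.IH[of b] Cons.IH[of y] by auto
qed simp

text \<open>
  The ascending pairs with one letter in \<open>u\<close> and one in \<open>v\<close> depend on \<open>u\<close> only through its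
  multiset of letters, so rearranging a prefix affects only the pairs inside it.
\<close>

lemma pair_ascents_append:
  "pair_ascents (u @ v) = pair_ascents u + pair_ascents v +
    (\<Sum>x\<in>#mset u. length (filter (\<lambda>y. x < y) v))"
  by (induction u) auto

fun prefix_sweep :: "nat \<Rightarrow> nat \<Rightarrow> nat list \<Rightarrow> nat list" where
  "prefix_sweep x (Suc a) (b # w) = sweep x b (take a w) @ drop a w"
| "prefix_sweep x a w = w"

lemma mset_prefix_sweep [simp]: "mset (prefix_sweep x a w) = mset w"
proof (cases "(x, a, w)" rule: prefix_sweep.cases)
  case (1 x' a' b v)
  have "mset (take a' v) + mset (drop a' v) = mset v"
    by (metis append_take_drop_id mset_append)
  then show ?thesis
    using 1 by simp
qed auto

lemma length_prefix_sweep [simp]: "length (prefix_sweep x a w) = length w"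
  by (metis mset_prefix_sweep mset_eq_length)

lemma prefix_sweep_inject:
  assumes "prefix_sweep x a w = prefix_sweep x a w'"
  shows "w = w'"
proof -
  have len: "length w = length w'"
    using assms by (metis length_prefix_sweep)
  show ?thesis
  proof (cases "(x, a, w)" rule: prefix_sweep.cases)
    case (1 x' a' b v)
    then obtain b' v' where w': "w' = b' # v'"
      using len by (cases w') auto
    have "sweep x b (take a' v) @ drop a' v = sweep x b' (take a' v') @ drop a' v'"
      using assms 1 w' by simp
    then have "sweep x b (take a' v) = sweep x b' (take a' v') \<and> drop a' v = drop a' v'"
      using len 1 w' by (subst (asm) append_eq_append_conv) auto
    then show ?thesis
      using 1 w' sweep_inject by (metis append_take_drop_id prod.inject)
  qed (use assms len in auto)
qed

lemma prefix_sweep_short: "a \<le> 1 \<Longrightarrow> prefix_sweep x a w = w"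
  by (cases "(x, a, w)" rule: prefix_sweep.cases) auto

lemma length_filter_take_prefix_sweep:
  "length (filter P (take a (prefix_sweep x a w))) = length (filter P (take a w))"
  by (cases "(x, a, w)" rule: prefix_sweep.cases) (auto simp: min_def not_le)

text \<open>
  With \<open>x\<close> in front, the letters above \<open>x\<close> in the
  prefix are new ascending edges. If the first letter of \<open>w\<close> is above \<open>x\<close>, then
  the sweep gains one pair for each letter of the prefix that is not above \<open>x\<close>, so that all \<open>a\<close> letters are
  counted. If it is not, the sweep loses one pair for each letter above \<open>x\<close>, and the two effects
  cancel.
\<close>

lemma pair_ascents_prefix_sweep:
  assumes "a \<le> length w"
  shows "length (filter (\<lambda>y. x < y) (take a w)) + pair_ascents (prefix_sweep x a w) =
    (if w \<noteq> [] \<and> x < hd w then a else 0) + pair_ascents w"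
proof (cases "(x, a, w)" rule: prefix_sweep.cases)
  case (1 x' a' b v)
  let ?p = "take a' v" and ?r = "drop a' v"
  have "pair_ascents (prefix_sweep x a w) + pair_ascents (b # ?p) =
      pair_ascents (sweep x b ?p) + pair_ascents ((b # ?p) @ ?r)"
    unfolding pair_ascents_append using 1 by (simp add: pair_ascents_append)
  then have "pair_ascents (prefix_sweep x a w) + pair_ascents (b # ?p) =
      pair_ascents (sweep x b ?p) + pair_ascents w"
    using 1 by simp
  moreover have "length (filter (\<lambda>y. x < y) ?p) + length (filter (\<lambda>y. \<not> x < y) ?p) = a'"
    using sum_length_filter_compl[of "\<lambda>y. x < y" ?p] assms 1 by simp
  ultimately show ?thesis
    using pair_ascents_sweep[of x b ?p] 1 by (auto split: if_splits)
qed (use assms in auto)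

fun foata :: "nat list \<Rightarrow> nat list \<Rightarrow> nat list" where
  "foata (a # as) (x # w) = x # prefix_sweep x a (foata as w)"
| "foata _ w = w"

lemma mset_foata [simp]: "mset (foata as w) = mset w"
  by (induction as w rule: foata.induct) auto

lemma set_foata [simp]: "set (foata as w) = set w"
  by (metis mset_foata set_mset_mset)

lemma length_foata [simp]: "length (foata as w) = length w"
  by (metis mset_foata mset_eq_length)

lemma foata_eq_Nil_iff [simp]: "foata as w = [] \<longleftrightarrow> w = []"
  by (metis length_foata length_0_conv)

text \<open>
  In the induction, \<open>pair_ascents_prefix_sweep\<close> compares \<open>x\<close> with the first letter of the transformed word, whereas
  \<open>area_major\<close> compares it with the first letter of the original one.
\<close>

lemma hd_foata: "hd (foata as w) = hd w"
  by (cases "(as, w)" rule: foata.cases) auto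

lemma inj_foata: "inj (foata as)"
proof (rule injI)
  show "w = w'" if "foata as w = foata as w'" for w w'
    using that
  proof (induction as w arbitrary: w' rule: foata.induct)
    case (1 a as x w)
    then obtain x' v where w': "w' = x' # v"
      by (cases w') auto
    then have "x = x'" "prefix_sweep x a (foata as w) = prefix_sweep x a (foata as v)"
      using 1 by auto
    then show ?case
      using 1 w' prefix_sweep_inject by blast
  next
    case ("2_2" as)
    then show ?case
      by (metis foata_eq_Nil_iff)
  qed auto
qed

text \<open>
  The area lists for which the transformation works: a vertex joined to more than one later vertex is
  followed by a complete graph. In particular a path may precede a clique of which the first vertex
  has lost some edges.
\<close>

fun melting_areas :: "nat list \<Rightarrow> bool" where
  "melting_areas [] = True"
| "melting_areas (a # as) \<longleftrightarrow>
    a \<le> length as \<and> (a \<le> 1 \<or> as = rev [0..<length as]) \<and> melting_areas as"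

lemma area_ascents_foata:
  assumes "melting_areas as" "length as = length w"
  shows "area_ascents as (foata as w) = area_major as w"
  using assms(2,1)
proof (induction as w rule: list_induct2)
  case (Cons a as x w)
  let ?u = "foata as w"
  have u: "length ?u = length as"
    using Cons.hyps by simp
  have "length (filter (\<lambda>y. x < y) (take a ?u)) + area_ascents as (prefix_sweep x a ?u) =
      (if ?u \<noteq> [] \<and> x < hd ?u then a else 0) + area_ascents as ?u"
  \<comment> \<open>For \<open>a \<le> 1\<close> the sweep is trivial, and the count is \<open>a\<close> exactly if the one neighbour of the new
    letter is larger; for larger \<open>a\<close> the remaining word lies on a complete graph.\<close>
  proof (cases "a \<le> 1")
    case True
    then consider "a = 0" | "a = 1" by linarith
    then show ?thesis
    proof cases
      case 2
      moreover from this have "?u \<noteq> []"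
        using Cons.prems u by auto
      ultimately show ?thesis
        by (simp add: prefix_sweep_short take_Suc)
    qed (simp add: prefix_sweep_short)
  next
    case False
    then have as: "as = rev [0..<length as]"
      using Cons.prems by auto
    have "area_ascents as v = pair_ascents v" if "length v = length as" for v
      using that as area_ascents_complete by metis
    then show ?thesis
      using pair_ascents_prefix_sweep[of a ?u x] Cons.prems u by simp
  qed
  then show ?case
    using Cons.IH Cons.prems by (simp add: length_filter_take_prefix_sweep hd_foata)
qed simp

section \<open>Compositions and subsets\<close>

lemma comp_set_Cons:
  "comp_set (a # \<alpha>) = (if \<alpha> = [] then {} else insert a ((+) a ` comp_set \<alpha>))"
proof (cases "\<alpha> = []")
  case False
  have indices: "{1..<length (a # \<alpha>)} = insert 1 (Suc ` {1..<length \<alpha>})"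
    using False by (simp only: image_Suc_atLeastLessThan) auto
  have partial_sums: "comp_set \<beta> = (\<lambda>i. sum_list (take i \<beta>)) ` {1..<length \<beta>}" for \<beta>
    by (auto simp: comp_set_def)
  have "comp_set (a # \<alpha>) = insert a ((+) a ` comp_set \<alpha>)"
    unfolding partial_sums indices image_insert image_image by simp
  then show ?thesis
    using False by simp
qed (simp add: comp_set_def)

lemma comp_set_subset:
  assumes "\<forall>a \<in> set \<alpha>. 0 < a"
  shows "comp_set \<alpha> \<subseteq> {1..<sum_list \<alpha>}"
  using assms
proof (induction \<alpha>)
  case (Cons a \<alpha>)
  have "0 < sum_list \<alpha>" if "\<alpha> \<noteq> []"
    using that Cons.prems by (cases \<alpha>) auto
  then show ?case
    using Cons by (auto simp: comp_set_Cons)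
qed (simp add: comp_set_def)

text \<open>
  The first part of a composition with at least two parts is the least element of its set, so the
  parts can be recovered one after the other; the total gives the last part.
\<close>

lemma comp_set_inject:
  assumes "\<forall>a \<in> set \<alpha>. 0 < a" "\<forall>b \<in> set \<beta>. 0 < b"
    and "sum_list \<alpha> = sum_list \<beta>" "comp_set \<alpha> = comp_set \<beta>"
  shows "\<alpha> = \<beta>"
  using assms
proof (induction \<alpha> arbitrary: \<beta>)
  case Nil
  then show ?case by (cases \<beta>) auto
next
  case (Cons a \<alpha>)
  then obtain b \<gamma> where \<beta>: "\<beta> = b # \<gamma>"
    by (cases \<beta>) auto
  show ?case
  proof (cases "\<alpha> = [] \<or> \<gamma> = []")
    case True
    then show ?thesis
      using Cons.prems \<beta> by (auto simp: comp_set_Cons split: if_splits)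
  next
    case False
    have pos: "0 \<notin> comp_set \<alpha>" "0 \<notin> comp_set \<gamma>"
      using comp_set_subset[of \<alpha>] comp_set_subset[of \<gamma>] Cons.prems(1,2) \<beta> by auto
    have eq: "insert a ((+) a ` comp_set \<alpha>) = insert b ((+) b ` comp_set \<gamma>)"
      using False Cons.prems(4) \<beta> by (simp add: comp_set_Cons)
    \<comment> \<open>Each of \<open>a\<close> and \<open>b\<close> lies in the common set and is its least element.\<close>
    have "a \<in> insert b ((+) b ` comp_set \<gamma>)" "b \<in> insert a ((+) a ` comp_set \<alpha>)"
      using eq by blast+
    then have ab: "a = b"
      by auto
    have "a \<notin> (+) a ` comp_set \<alpha>" "a \<notin> (+) a ` comp_set \<gamma>"
      using pos by auto
    then have "(+) a ` comp_set \<alpha> = (+) a ` comp_set \<gamma>"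
      using eq ab by (metis insert_ident)
    then have "comp_set \<alpha> = comp_set \<gamma>"
      by (simp add: inj_image_eq_iff)
    then show ?thesis
      using Cons.IH[of \<gamma>] Cons.prems ab \<beta> by simp
  qed
qed

lemma ex_comp_set:
  assumes "0 < n" "S \<subseteq> {1..<n}"
  shows "\<exists>\<alpha> \<in> compositions n. comp_set \<alpha> = S"
  using assms
proof (induction n arbitrary: S rule: less_induct)
  case (less n)
  show ?case
  proof (cases "S = {}")
    case True
    then show ?thesis
      using less.prems
      by (intro bexI[of _ "[n]"]) (auto simp: compositions_def comp_set_def)
  next
    case False
    have fin: "finite S"
      using less.prems(2) finite_subset by blast
    define a where "a = Min S"
    have aS: "a \<in> S" and le: "\<And>s. s \<in> S \<Longrightarrow> a \<le> s"
      using False fin by (auto simp: a_def)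
    then have a: "0 < a" "a < n"
      using less.prems(2) by auto
    define T where "T = (\<lambda>s. s - a) ` (S - {a})"
    have S: "S = insert a ((+) a ` T)"
      using aS le by (auto simp: T_def image_image)
    have "T \<subseteq> {1..<n - a}"
    proof
      fix t assume "t \<in> T"
      then obtain s where s: "t = s - a" "s \<in> S" "s \<noteq> a"
        by (auto simp: T_def)
      then have "a < s" "s < n"
        using le[of s] less.prems(2) by auto
      then show "t \<in> {1..<n - a}"
        using s by auto
    qed
    then obtain \<beta> where \<beta>: "\<beta> \<in> compositions (n - a)" "comp_set \<beta> = T"
      using less.IH[of "n - a" T] a by auto
    have "\<beta> \<noteq> []"
      using \<beta>(1) a by (auto simp: compositions_def)
    then have "comp_set (a # \<beta>) = S"
      using S \<beta>(2) by (simp add: comp_set_Cons)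
    moreover have "a # \<beta> \<in> compositions n"
      using \<beta>(1) a by (auto simp: compositions_def)
    ultimately show ?thesis
      by blast
  qed
qed

lemma bij_betw_comp_set:
  assumes "0 < n"
  shows "bij_betw comp_set (compositions n) (Pow {1..<n})"
  unfolding bij_betw_def
proof
  show "inj_on comp_set (compositions n)"
    by (auto simp: inj_on_def compositions_def intro: comp_set_inject)
  show "comp_set ` compositions n = Pow {1..<n}"
  proof
    show "comp_set ` compositions n \<subseteq> Pow {1..<n}"
      using comp_set_subset unfolding compositions_def by blast
    show "Pow {1..<n} \<subseteq> comp_set ` compositions n"
      using ex_comp_set[OF assms] by blast
  qed
qed

definition ascent_set :: "nat \<Rightarrow> (nat \<Rightarrow> nat) \<Rightarrow> nat set" where
  "ascent_set n \<kappa> = {i \<in> {1..<n}. \<kappa> i < \<kappa> (i + 1)}"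

lemma ribbon_schur_altdef:
  assumes "\<alpha> \<in> compositions n"
  shows "ribbon_schur \<alpha> =
    formal_sum n {\<kappa> \<in> colourings n. ascent_set n \<kappa> = comp_set \<alpha>} (\<lambda>\<kappa>. 1)"
proof -
  have "comp_set \<alpha> \<subseteq> {1..<n}" "sum_list \<alpha> = n"
    using assms comp_set_subset by (auto simp: compositions_def)
  then have "(\<forall>i \<in> {1..<n}. (i \<in> comp_set \<alpha> \<longrightarrow> \<kappa> i < \<kappa> (i + 1)) \<and>
      (i \<notin> comp_set \<alpha> \<longrightarrow> \<kappa> i \<ge> \<kappa> (i + 1))) \<longleftrightarrow> ascent_set n \<kappa> = comp_set \<alpha>" for \<kappa>
    by (auto simp: ascent_set_def set_eq_iff subset_iff not_less)
      (meson atLeastLessThan_iff not_less One_nat_def)+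
  then show ?thesis
    using \<open>sum_list \<alpha> = n\<close> by (simp add: ribbon_schur_def)
qed

text \<open>
  The colourings are partitioned by their ascent sets, and every subset of \<open>{1..<n}\<close> is the set of
  exactly one composition.
\<close>

lemma sum_ribbon_schur:
  assumes "0 < n"
  shows "(\<Sum>\<alpha> \<in> compositions n. f (comp_set \<alpha>) * ribbon_schur \<alpha> \<mu>) =
    formal_sum n (colourings n) (\<lambda>\<kappa>. f (ascent_set n \<kappa>)) \<mu>"
proof -
  let ?K = "{\<kappa> \<in> colourings n. monomial n \<kappa> = \<mu>}"
  have "(\<Sum>\<alpha> \<in> compositions n. f (comp_set \<alpha>) * ribbon_schur \<alpha> \<mu>) =
      (\<Sum>\<alpha> \<in> compositions n. \<Sum>\<kappa> \<in> {\<kappa> \<in> ?K. ascent_set n \<kappa> = comp_set \<alpha>}. f (ascent_set n \<kappa>))"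
  proof (rule sum.cong[OF refl])
    fix \<alpha> assume "\<alpha> \<in> compositions n"
    moreover have "{\<kappa> \<in> {\<kappa> \<in> colourings n. ascent_set n \<kappa> = comp_set \<alpha>}. monomial n \<kappa> = \<mu>} =
        {\<kappa> \<in> ?K. ascent_set n \<kappa> = comp_set \<alpha>}"
      by auto
    ultimately show "f (comp_set \<alpha>) * ribbon_schur \<alpha> \<mu> =
        (\<Sum>\<kappa> \<in> {\<kappa> \<in> ?K. ascent_set n \<kappa> = comp_set \<alpha>}. f (ascent_set n \<kappa>))"
      by (simp add: ribbon_schur_altdef formal_sum_def mult.commute)
  qed
  also have "\<dots> = (\<Sum>S \<in> Pow {1..<n}. \<Sum>\<kappa> \<in> {\<kappa> \<in> ?K. ascent_set n \<kappa> = S}. f (ascent_set n \<kappa>))"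
    by (rule sum.reindex_bij_betw[OF bij_betw_comp_set[OF assms]])
  also have "\<dots> = (\<Sum>\<kappa> \<in> ?K. f (ascent_set n \<kappa>))"
    by (rule sum.group) (auto simp: finite_colourings_monomial ascent_set_def)
  finally show ?thesis
    by (simp add: formal_sum_def)
qed

section \<open>Colourings as words\<close>

definition colour_word :: "nat \<Rightarrow> (nat \<Rightarrow> nat) \<Rightarrow> nat list" where
  "colour_word n \<kappa> = map (\<lambda>i. \<kappa> (Suc i)) [0..<n]"

lemma length_colour_word [simp]: "length (colour_word n \<kappa>) = n"
  by (simp add: colour_word_def)

lemma nth_colour_word [simp]: "i < n \<Longrightarrow> colour_word n \<kappa> ! i = \<kappa> (Suc i)"
  by (simp add: colour_word_def)

lemma inj_on_colour_word: "inj_on (colour_word n) (colourings n)"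
proof (rule inj_onI)
  fix \<kappa> \<kappa>' assume \<kappa>: "\<kappa> \<in> colourings n" "\<kappa>' \<in> colourings n"
    and eq: "colour_word n \<kappa> = colour_word n \<kappa>'"
  have "\<kappa> i = \<kappa>' i" if "i \<in> {1..n}" for i
    using that arg_cong[OF eq, of "\<lambda>w. w ! (i - 1)"] by (cases i) auto
  then show "\<kappa> = \<kappa>'"
    using \<kappa> unfolding colourings_def by (blast intro: PiE_ext)
qed

lemma monomial_eq_colour_word:
  "monomial n \<kappa> = (\<Sum>x\<in>#mset (colour_word n \<kappa>). Poly_Mapping.single x 1)"
proof -
  have "monomial n \<kappa> = (\<Sum>i<n. Poly_Mapping.single (\<kappa> (Suc i)) 1)"
    unfolding monomial_def
    by (rule sum.reindex_bij_witness[of _ Suc "\<lambda>i. i - 1"]) auto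
  also have "\<dots> = sum_list (map (\<lambda>i. Poly_Mapping.single (\<kappa> (Suc i)) 1) [0..<n])"
    by (simp add: sum_list_distinct_conv_sum_set atLeast0LessThan)
  also have "\<dots> = (\<Sum>x\<in>#mset (colour_word n \<kappa>). Poly_Mapping.single x 1)"
    by (simp add: colour_word_def comp_def flip: sum_mset_sum_list mset_map)
  finally show ?thesis .
qed

text \<open>
  Membership on the right depends only on the length and the multiset of letters, so this set of
  words is closed under every transformation that rearranges letters.
\<close>

lemma colour_word_image:
  "colour_word n ` {\<kappa> \<in> colourings n. monomial n \<kappa> = \<mu>} =
    {w. length w = n \<and> set_mset (mset w) \<subseteq> {1..} \<and>
        (\<Sum>x\<in>#mset w. Poly_Mapping.single x 1) = \<mu>}" (is "_ ` ?K = ?W")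
proof (intro equalityI subsetI)
  fix w assume "w \<in> colour_word n ` ?K"
  then show "w \<in> ?W"
    by (fastforce simp: monomial_eq_colour_word colourings_def PiE_iff colour_word_def)
next
  fix w assume w: "w \<in> ?W"
  define \<kappa> where "\<kappa> = restrict (\<lambda>i. w ! (i - 1)) {1..n}"
  have word: "colour_word n \<kappa> = w"
    using w by (intro nth_equalityI) (auto simp: \<kappa>_def)
  have "w ! (i - 1) \<in> set w" if "i \<in> {1..n}" for i
    using that w by (intro nth_mem) auto
  then have "\<kappa> \<in> colourings n"
    using w by (fastforce simp: colourings_def \<kappa>_def PiE_iff)
  then show "w \<in> colour_word n ` ?K"
    using w word by (intro image_eqI[of _ _ \<kappa>]) (auto simp: monomial_eq_colour_word)
qed

lemma formal_sum_area_equidistribution: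
  assumes "melting_areas as" "length as = n"
  shows "formal_sum n (colourings n) (\<lambda>\<kappa>. f (area_ascents as (colour_word n \<kappa>))) =
    formal_sum n (colourings n) (\<lambda>\<kappa>. f (area_major as (colour_word n \<kappa>)))"
proof
  fix \<mu>
  let ?K = "{\<kappa> \<in> colourings n. monomial n \<kappa> = \<mu>}"
  define W where "W = colour_word n ` ?K"
  have inj: "inj_on (colour_word n) ?K"
    by (rule inj_on_subset[OF inj_on_colour_word]) auto
  have "finite W"
    by (simp add: W_def finite_colourings_monomial)
  moreover have "foata as ` W \<subseteq> W"
    unfolding W_def colour_word_image by auto
  ultimately have bij: "bij_betw (foata as) W W"
    using inj_foata by (metis endo_inj_surj bij_betw_def inj_on_subset subset_UNIV)
  have "(\<Sum>\<kappa> \<in> ?K. f (area_ascents as (colour_word n \<kappa>))) = (\<Sum>w \<in> W. f (area_ascents as w))"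
    by (simp add: W_def sum.reindex[OF inj])
  also have "\<dots> = (\<Sum>w \<in> W. f (area_ascents as (foata as w)))"
    by (rule sum.reindex_bij_betw[OF bij, symmetric])
  also have "\<dots> = (\<Sum>w \<in> W. f (area_major as w))"
    using assms by (intro sum.cong refl arg_cong[where f = f] area_ascents_foata) (auto simp: W_def)
  also have "\<dots> = (\<Sum>\<kappa> \<in> ?K. f (area_major as (colour_word n \<kappa>)))"
    by (simp add: W_def sum.reindex[OF inj])
  finally show "formal_sum n (colourings n) (\<lambda>\<kappa>. f (area_ascents as (colour_word n \<kappa>))) \<mu> =
      formal_sum n (colourings n) (\<lambda>\<kappa>. f (area_major as (colour_word n \<kappa>))) \<mu>"
    by (simp add: formal_sum_def)
qed

section \<open>From graphs to area sequences\<close>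

lemma length_area_sequence [simp]: "length (area_sequence G) = vertex_count G - 1"
  by (simp add: area_sequence_def)

text \<open>
  In a unit interval graph the later neighbours of a vertex \<open>i\<close> are the \<open>a\<^sub>i\<close> vertices after it. Vertex
  \<open>i + 1\<close> is position \<open>i\<close> of the word, whence the shift by \<open>Suc\<close> in both coordinates.
\<close>

lemma asc_eq_area_ascents:
  assumes G: "unit_interval_graph G" and n: "vertex_count G = n" "0 < n"
  shows "asc G \<kappa> = area_ascents (area_sequence G @ [0]) (colour_word n \<kappa>)"
proof -
  let ?as = "area_sequence G @ [0]" and ?w = "colour_word n \<kappa>"
  let ?J = "\<lambda>i. {j. i < j \<and> j < length ?w \<and> j \<le> i + ?as ! i \<and> ?w ! i < ?w ! j}"
  have range: "1 \<le> i \<and> i < j \<and> j \<le> n" if "(i, j) \<in> edges G" for i j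
    using G n that by (auto simp: unit_interval_graph_def)
  have edge: "(Suc i, j) \<in> edges G \<longleftrightarrow> i < n \<and> Suc i < j \<and> j \<le> n \<and> j \<le> Suc i + ?as ! i" for i j
  proof (cases "Suc i < n")
    case True
    then show ?thesis
      using n range[of "Suc i" j] unit_interval_graph_edge_iff[OF G, of "Suc i" j]
      by (auto simp: nth_append)
  next
    case False
    then show ?thesis
      using range[of "Suc i" j] by auto
  qed
  have "{(i, j) \<in> edges G. i < j \<and> \<kappa> i < \<kappa> j} = map_prod Suc Suc ` (SIGMA i:{..<n}. ?J i)"
    (is "?A = ?B")
  proof (intro equalityI subrelI)
    fix i j assume ij: "(i, j) \<in> ?A"
    then obtain i' j' where ij': "i = Suc i'" "j = Suc j'"
      using range[of i j] by (cases i; cases j) auto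
    then have "(i', j') \<in> (SIGMA i:{..<n}. ?J i)"
      using ij by (auto simp: edge)
    then have "map_prod Suc Suc (i', j') \<in> ?B"
      by (rule imageI)
    then show "(i, j) \<in> ?B"
      unfolding ij' map_prod_simp .
  next
    fix i j assume "(i, j) \<in> ?B"
    then show "(i, j) \<in> ?A"
      by (auto simp: edge)
  qed
  then have "asc G \<kappa> = card (SIGMA i:{..<n}. ?J i)"
    by (simp add: asc_def card_image prod.inj_map inj_on_subset[OF prod.inj_map])
  also have "\<dots> = (\<Sum>i<n. card (?J i))"
    by (subst card_SigmaI) auto
  also have "\<dots> = area_ascents ?as ?w"
    by (subst area_ascents_eq_sum) (use n in auto)
  finally show ?thesis .
qed

lemma list_sum_on_ascent_set:
  assumes "length a = n - 1" "0 < n"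
  shows "list_sum_on a (ascent_set n \<kappa>) = area_major (a @ [0]) (colour_word n \<kappa>)"
proof -
  let ?w = "colour_word n \<kappa>"
  have "area_major (a @ [0]) ?w = (\<Sum>i \<in> {i. Suc i < n \<and> ?w ! i < ?w ! Suc i}. (a @ [0]) ! i)"
    using assms by (subst area_major_eq_sum) auto
  also have "\<dots> = (\<Sum>s \<in> ascent_set n \<kappa>. a ! (s - 1))"
    by (rule sum.reindex_bij_witness[of _ "\<lambda>s. s - 1" Suc])
      (use assms in \<open>auto simp: ascent_set_def nth_append\<close>)
  finally show ?thesis
    by (simp add: list_sum_on_def)
qed

lemma LLT_ribbon_expansion:
  assumes G: "unit_interval_graph G" "vertex_count G = n" "0 < n"
    and melting: "melting_areas (area_sequence G @ [0])"
  shows "LLT G = (\<lambda>\<mu>. \<Sum>\<alpha> \<in> compositions n.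
    monom 1 (list_sum_on (area_sequence G) (comp_set \<alpha>)) * ribbon_schur \<alpha> \<mu>)"
proof -
  let ?a = "area_sequence G"
  have "LLT G = formal_sum n (colourings n)
      (\<lambda>\<kappa>. monom 1 (area_ascents (?a @ [0]) (colour_word n \<kappa>)))"
    using G by (simp add: LLT_def asc_eq_area_ascents)
  also have "\<dots> = formal_sum n (colourings n)
      (\<lambda>\<kappa>. monom 1 (area_major (?a @ [0]) (colour_word n \<kappa>)))"
    using G by (intro formal_sum_area_equidistribution melting) simp
  also have "\<dots> = formal_sum n (colourings n) (\<lambda>\<kappa>. monom 1 (list_sum_on ?a (ascent_set n \<kappa>)))"
    using G by (simp add: list_sum_on_ascent_set)
  finally show ?thesis
    using sum_ribbon_schur[OF G(3), of "\<lambda>S. monom 1 (list_sum_on ?a S)"] by auto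
qed

section \<open>Melting lollipop graphs\<close>

lemma melting_lollipop_graph_edge_iff:
  assumes "1 \<le> m" "k \<le> m - 1"
  shows "(i, j) \<in> edges (melting_lollipop_graph m n k) \<longleftrightarrow>
    1 \<le> i \<and> i < j \<and>
    j \<le> i + (if i \<le> n then 1 else if i = n + 1 then m - 1 - k else n + m - i)"
    (is "(i, j) \<in> edges ?G \<longleftrightarrow> ?R")
proof
  assume "(i, j) \<in> edges ?G"
  then show ?R
    using assms
    by (auto simp: melting_lollipop_graph_def concatenation_def path_graph_def
        melting_complete_graph_def complete_graph_def)
next
  assume R: ?R
  show "(i, j) \<in> edges ?G"
  proof (cases "i \<le> n")
    case True
    then show ?thesis
      using R by (auto simp: melting_lollipop_graph_def concatenation_def path_graph_def)
  next
    case False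
    then have "(i - n, j - n) \<in> edges (melting_complete_graph m k)"
      using R assms
      by (auto simp: melting_complete_graph_def complete_graph_def split: if_splits)
    moreover have "i = (i - n) + n" "j = (j - n) + n"
      using False R by auto
    ultimately show ?thesis
      by (fastforce simp: melting_lollipop_graph_def concatenation_def path_graph_def)
  qed
qed

lemma area_sequence_melting_lollipop_graph:
  assumes "1 \<le> m" "k \<le> m - 1"
  shows "area_sequence (melting_lollipop_graph m n k) @ [0] =
    replicate n 1 @ (m - 1 - k) # rev [0..<m - 1]" (is "area_sequence ?G @ [0] = ?as")
proof (rule nth_equalityI)
  note G = unit_interval_graph_melting_lollipop_graph[OF assms, of n]
  show "length (area_sequence ?G @ [0]) = length ?as"
    using assms by (simp add: G)
  fix i assume i: "i < length (area_sequence ?G @ [0])"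
  let ?b = "if Suc i \<le> n then 1 else if Suc i = n + 1 then m - 1 - k else n + m - Suc i"
  have b: "?as ! i = ?b"
    using i assms by (auto simp: G nth_append nth_Cons' rev_nth)
  show "(area_sequence ?G @ [0]) ! i = ?as ! i"
  proof (cases "Suc i < n + m")
    case True
    let ?c = "area_sequence ?G ! i"
    have *: "Suc i < j \<and> j \<le> Suc i + ?c \<longleftrightarrow> Suc i < j \<and> j \<le> Suc i + ?b" for j
      using unit_interval_graph_edge_iff[OF G(1), of "Suc i" j] True
        melting_lollipop_graph_edge_iff[OF assms, of "Suc i" j n]
      by (simp only: G(2) diff_Suc_1) simp
    \<comment> \<open>Two intervals that start after \<open>Suc i\<close> and have the same elements have the same length.\<close>
    have "?c = ?b"
      using *[of "Suc i + ?c"] *[of "Suc i + ?b"] by linarith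
    moreover have "(area_sequence ?G @ [0]) ! i = ?c"
      using True by (simp add: nth_append G less_diff_conv)
    ultimately show ?thesis
      unfolding b by simp
  next
    case False
    then show ?thesis
      unfolding b using i assms by (auto simp: nth_append G)
  qed
qed

lemma melting_areas_complete: "melting_areas (rev [0..<l])"
  by (induction l) auto

lemma melting_areas_lollipop: "s \<le> l \<Longrightarrow> melting_areas (replicate n 1 @ s # rev [0..<l])"
  by (induction n) (auto simp: melting_areas_complete)

theorem theorem3p7:
  fixes n m k :: nat and a :: "nat list"
  assumes "m \<ge> 1" and "k \<le> m - 1"
    and "a = area_sequence (melting_lollipop_graph m n k)"
  shows "LLT (melting_lollipop_graph m n k) =
    (\<lambda>\<mu>. \<Sum>\<alpha> \<in> compositions (n + m).
        monom 1 (list_sum_on a (comp_set \<alpha>)) * ribbon_schur \<alpha> \<mu>)"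
  unfolding assms(3)
proof (rule LLT_ribbon_expansion)
  show "melting_areas (area_sequence (melting_lollipop_graph m n k) @ [0])"
    unfolding area_sequence_melting_lollipop_graph[OF assms(1,2)]
    by (rule melting_areas_lollipop) simp
qed (use assms unit_interval_graph_melting_lollipop_graph in auto)

end
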